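(* For any $\lambda>0$, the regularized Sinkhorn distance $\widetilde{\mathrm S}_\lambda:\Delta_n\times\Delta_n\to\mathbb{R}$ and the sharp Sinkhorn distance $\mathrm S_\lambda:\Delta_n\times\Delta_n\to\mathbb{R}$ are $C^\infty$ in the interior of their domain.
   Context: Let $\Delta_n=\{p\in\mathbb{R}^n : p_i\ge 0 \text{ for all } i,\ \sum_{i=1}^n p_i=1\}$ be the simplex. The interior of $\Delta_n\times\Delta_n$ is meant relative to the affine hull, i.e. it is the set of pairs $(a,b)$ all of whose entries are strictly positive; smoothness is as a function on this (relatively open) set. Fix points $x_1,\dots,x_n$ and $y_1,\dots,y_n$ in a space $X$ with distance $\mathsf d$, an exponent $p\ge1$, and the cost matrix $M\in\mathbb{R}^{n\times n}$, $M_{ij}=\mathsf d(x_i,y_j)^p$. Let $\mathbf 1_n\in\mathbb{R}^n$ be the all-ones vector. For $a,b\in\Delta_n$ let $$\Pi(a,b)=\{T\in\mathbb{R}_+^{n\times n} : T\mathbf 1_n=a,\ T^\top\mathbf 1_n=b\}$$ be the transportation polytope ($\mathbb{R}_+^{n\times n}$ is the set of entrywise nonnegative matrices), $\langle T,M\rangle=\mathrm{Tr}(T^\top M)$, and $h(T)=-\sum_{i,j}T_{ij}(\log T_{ij}-1)$ (with $0\log 0=0$). For $\lambda>0$ let $$T_\lambda=T_\lambda(a,b)=\operatorname*{argmin}_{T\in\Pi(a,b)}\ \langle T,M\rangle-\tfrac1\lambda h(T)$$ be the unique minimizer. The regularized Sinkhorn distance is $$\widetilde{\mathrm S}_\lambda(a,b)=\min_{T\in\Pi(a,b)}\langle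 T,M\rangle-\tfrac1\lambda h(T)=\langle T_\lambda,M\rangle-\tfrac1\lambda h(T_\lambda),$$ and the sharp Sinkhorn distance is $\mathrm S_\lambda(a,b)=\langle T_\lambda(a,b),M\rangle$. *)

theory Defs
  imports "HOL-Analysis.Analysis" "HOL-Real_Asymp.Real_Asymp"
begin

definition prob_simplex :: "(real ^ 'n) set" where
  "prob_simplex = {q. (\<forall>i. 0 \<le> q $ i) \<and> (\<Sum>i\<in>UNIV. q $ i) = 1}"

definition cost_matrix ::
  "('x \<Rightarrow> 'x \<Rightarrow> real) \<Rightarrow> real \<Rightarrow> ('n \<Rightarrow> 'x) \<Rightarrow> ('n \<Rightarrow> 'x) \<Rightarrow> real ^ 'n ^ 'n" where
  "cost_matrix d p x y = (\<chi> i j. d (x i) (y j) powr p)"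

(* In the type real ^ 'n, the constant 1 is the all-ones vector. *)
definition transport_polytope :: "real ^ 'n \<Rightarrow> real ^ 'n \<Rightarrow> (real ^ 'n ^ 'n) set" where
  "transport_polytope a b = {T. (\<forall>i j. 0 \<le> T $ i $ j) \<and> T *v 1 = a \<and> transpose T *v 1 = b}"

definition frob_inner :: "real ^ 'n ^ 'n \<Rightarrow> real ^ 'n ^ 'n \<Rightarrow> real" where
  "frob_inner T M = trace (transpose T ** M)"

(* The convention 0 log 0 = 0 is automatic, since the factor T $ i $ j vanishes. *)
definition entropy :: "real ^ 'n ^ 'n \<Rightarrow> real" where
  "entropy T = - (\<Sum>i\<in>UNIV. \<Sum>j\<in>UNIV. T $ i $ j * (ln (T $ i $ j) - 1))"

definition sinkhorn_objective :: "real \<Rightarrow> real ^ 'n ^ 'n \<Rightarrow> real ^ 'n ^ 'n \<Rightarrow> real" where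
  "sinkhorn_objective l M T = frob_inner T M - 1 / l * entropy T"

(* Well-defined on the simplex for l > 0: see sinkhorn_minimizer_ex1 below. *)
definition sinkhorn_plan ::
  "real \<Rightarrow> real ^ 'n ^ 'n \<Rightarrow> real ^ 'n \<Rightarrow> real ^ 'n \<Rightarrow> real ^ 'n ^ 'n" where
  "sinkhorn_plan l M a b = arg_min_on (sinkhorn_objective l M) (transport_polytope a b)"

(* The infimum is attained, at the plan: see regularized_sinkhorn_eq below. *)
definition regularized_sinkhorn ::
  "real \<Rightarrow> real ^ 'n ^ 'n \<Rightarrow> real ^ 'n \<Rightarrow> real ^ 'n \<Rightarrow> real" where
  "regularized_sinkhorn l M a b = (INF T\<in>transport_polytope a b. sinkhorn_objective l M T)"

definition sharp_sinkhorn ::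
  "real \<Rightarrow> real ^ 'n ^ 'n \<Rightarrow> real ^ 'n \<Rightarrow> real ^ 'n \<Rightarrow> real" where
  "sharp_sinkhorn l M a b = frob_inner (sinkhorn_plan l M a b) M"

(* C^k on a relatively open subset S of an affine subspace with direction space W.
   The derivative is taken within S, so it is determined by f exactly on W; off W it may be
   chosen freely (for instance 0 on a complement), so the condition only concerns the
   derivatives of f in directions tangent to S. In finite dimension, continuity of
   x |-> f' x v for every v is continuity of f' in operator norm. *)
primrec Ck_on :: "nat \<Rightarrow> ('a::euclidean_space \<Rightarrow> real) \<Rightarrow> 'a set \<Rightarrow> bool" where
  "Ck_on 0 f S \<longleftrightarrow> continuous_on S f"
| "Ck_on (Suc k) f S \<longleftrightarrow>
     (\<exists>f'. (\<forall>x\<in>S. (f has_derivative f' x) (at x within S)) \<and> (\<forall>v. Ck_on k (\<lambda>x. f' x v) S))"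

definition smooth_on :: "('a::euclidean_space \<Rightarrow> real) \<Rightarrow> 'a set \<Rightarrow> bool" where
  "smooth_on f S \<longleftrightarrow> (\<forall>k. Ck_on k f S)"

lemma mem_transport_polytope:
  "T \<in> transport_polytope a b \<longleftrightarrow> (\<forall>i j. 0 \<le> T $ i $ j) \<and>
     (\<forall>i. (\<Sum>j\<in>UNIV. T $ i $ j) = a $ i) \<and> (\<forall>j. (\<Sum>i\<in>UNIV. T $ i $ j) = b $ j)"
  by (simp add: transport_polytope_def vec_eq_iff matrix_vector_mult_def transpose_def)

lemma frob_inner_sum: "frob_inner T M = (\<Sum>j\<in>UNIV. \<Sum>i\<in>UNIV. T $ i $ j * M $ i $ j)"
  by (simp add: frob_inner_def trace_def matrix_matrix_mult_def transpose_def)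

lemma entropy_tangent:
  fixes x m :: real
  assumes "0 \<le> x" "0 < m"
  shows "x - m \<le> x * ln x - x * ln m" and "x \<noteq> m \<Longrightarrow> x - m < x * ln x - x * ln m"
proof -
  have strict: "x - m < x * ln x - x * ln m" if "x \<noteq> m"
  proof (cases "x = 0")
    case False
    then have x: "0 < x" using assms by simp
    have "ln (m / x) \<noteq> m / x - 1"
      using ln_eq_minus_one[of "m / x"] x assms that by auto
    then have "ln (m / x) < m / x - 1"
      using ln_le_minus_one[of "m / x"] x assms by simp
    then have "x * ln (m / x) < x * (m / x - 1)"
      using x by (rule mult_strict_left_mono)
    then show ?thesis
      using x assms by (simp add: ln_div algebra_simps)
  qed (use assms in simp)
  then show "x \<noteq> m \<Longrightarrow> x - m < x * ln x - x * ln m" .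
  show "x - m \<le> x * ln x - x * ln m" using strict by (cases "x = m") auto
qed

lemma entropy_midpoint:
  fixes x y :: real
  assumes "0 \<le> x" "0 \<le> y"
  defines "m \<equiv> (x + y) / 2"
  shows "2 * (m * (ln m - 1)) \<le> x * (ln x - 1) + y * (ln y - 1)"
    and "x \<noteq> y \<Longrightarrow> 2 * (m * (ln m - 1)) < x * (ln x - 1) + y * (ln y - 1)"
proof -
  have s: "2 * (m * ln m) = x * ln m + y * ln m" by (simp add: m_def field_simps)
  have strict: "2 * (m * (ln m - 1)) < x * (ln x - 1) + y * (ln y - 1)" if "x \<noteq> y"
  proof -
    have m: "0 < m" "x \<noteq> m" "y \<noteq> m" using assms that by (auto simp: m_def)
    show ?thesis
      using entropy_tangent(2)[OF assms(1) m(1,2)] entropy_tangent(2)[OF assms(2) m(1,3)] s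
      unfolding right_diff_distrib by linarith
  qed
  then show "x \<noteq> y \<Longrightarrow> 2 * (m * (ln m - 1)) < x * (ln x - 1) + y * (ln y - 1)" .
  show "2 * (m * (ln m - 1)) \<le> x * (ln x - 1) + y * (ln y - 1)"
    using strict by (cases "x = y") (auto simp: m_def)
qed

lemma sinkhorn_objective_midpoint:
  fixes T U M :: "real ^ 'n ^ 'n"
  assumes l: "0 < l" and T: "\<forall>i j. 0 \<le> T $ i $ j" and U: "\<forall>i j. 0 \<le> U $ i $ j" and "T \<noteq> U"
  shows "2 * sinkhorn_objective l M (\<chi> i j. (T $ i $ j + U $ i $ j) / 2)
    < sinkhorn_objective l M T + sinkhorn_objective l M U"
proof -
  define \<phi> :: "real \<Rightarrow> real" where "\<phi> t = t * (ln t - 1)" for t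
  have le: "2 * \<phi> ((T $ i $ j + U $ i $ j) / 2) \<le> \<phi> (T $ i $ j) + \<phi> (U $ i $ j)" for i j
    unfolding \<phi>_def using entropy_midpoint(1) T U by blast
  obtain i0 j0 where "T $ i0 $ j0 \<noteq> U $ i0 $ j0" using \<open>T \<noteq> U\<close> by (auto simp: vec_eq_iff)
  then have lt: "2 * \<phi> ((T $ i0 $ j0 + U $ i0 $ j0) / 2) < \<phi> (T $ i0 $ j0) + \<phi> (U $ i0 $ j0)"
    unfolding \<phi>_def using entropy_midpoint(2) T U by blast
  have "(\<Sum>i\<in>UNIV. \<Sum>j\<in>UNIV. 2 * \<phi> ((T $ i $ j + U $ i $ j) / 2))
      < (\<Sum>i\<in>UNIV. \<Sum>j\<in>UNIV. \<phi> (T $ i $ j) + \<phi> (U $ i $ j))"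
  proof (rule sum_strict_mono_ex1)
    show "\<exists>i\<in>UNIV. (\<Sum>j\<in>UNIV. 2 * \<phi> ((T $ i $ j + U $ i $ j) / 2))
        < (\<Sum>j\<in>UNIV. \<phi> (T $ i $ j) + \<phi> (U $ i $ j))"
      by (rule bexI[of _ i0], rule sum_strict_mono_ex1) (use le lt in auto)
  qed (use le in \<open>auto intro: sum_mono\<close>)
  then have "1 / l * (2 * (\<Sum>i\<in>UNIV. \<Sum>j\<in>UNIV. \<phi> ((T $ i $ j + U $ i $ j) / 2)))
      < 1 / l * ((\<Sum>i\<in>UNIV. \<Sum>j\<in>UNIV. \<phi> (T $ i $ j)) + (\<Sum>i\<in>UNIV. \<Sum>j\<in>UNIV. \<phi> (U $ i $ j)))"
    using l by (intro mult_strict_left_mono) (simp_all add: sum.distrib sum_distrib_left)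
  moreover have "2 * frob_inner (\<chi> i j. (T $ i $ j + U $ i $ j) / 2) M
      = frob_inner T M + frob_inner U M"
    unfolding frob_inner_sum sum_distrib_left sum.distrib[symmetric]
    by (intro sum.cong refl) (simp add: field_simps)
  ultimately show ?thesis
    unfolding sinkhorn_objective_def entropy_def by (simp add: \<phi>_def algebra_simps)
qed

lemma continuous_on_mult_ln: "continuous_on {0..} (\<lambda>t::real. t * (ln t - 1))"
proof -
  have "continuous (at t within {0..}) (\<lambda>t::real. t * (ln t - 1))" if "0 \<le> t" for t :: real
  proof (cases "t = 0")
    case True
    have "((\<lambda>t::real. t * (ln t - 1)) \<longlongrightarrow> 0) (at_right 0)" by real_asymp
    moreover have "(at 0 within {0::real..}) = at_right 0"
      by (metis at_within_Icc_at_right at_within_Ici_at_right)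
    ultimately show ?thesis using True by (simp add: continuous_within)
  next
    case False
    then show ?thesis using that by (intro continuous_intros) auto
  qed
  then show ?thesis by (simp add: continuous_on_eq_continuous_within)
qed

lemma compact_transport_polytope: "compact (transport_polytope a b)"
proof -
  have eq: "transport_polytope a b = (\<Inter>i j. {T. 0 \<le> T $ i $ j}) \<inter>
      (\<Inter>i. {T. (\<Sum>j\<in>UNIV. T $ i $ j) = a $ i}) \<inter> (\<Inter>j. {T. (\<Sum>i\<in>UNIV. T $ i $ j) = b $ j})"
    by (auto simp: mem_transport_polytope)
  have cl: "closed (transport_polytope a b)"
    unfolding eq
    by (intro closed_Int closed_INT ballI closed_Collect_le closed_Collect_eq continuous_intros)
  have "norm T \<le> (\<Sum>i\<in>UNIV. \<bar>a $ i\<bar>)" if "T \<in> transport_polytope a b" for T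
  proof -
    have "norm T \<le> (\<Sum>i\<in>UNIV. norm (T $ i))"
      unfolding norm_vec_def by (rule L2_set_le_sum) simp
    also have "\<dots> \<le> (\<Sum>i\<in>UNIV. \<Sum>j\<in>UNIV. \<bar>T $ i $ j\<bar>)"
      by (intro sum_mono norm_le_l1_cart)
    also have "\<dots> = (\<Sum>i\<in>UNIV. a $ i)" using that by (simp add: mem_transport_polytope)
    also have "\<dots> \<le> (\<Sum>i\<in>UNIV. \<bar>a $ i\<bar>)" by (intro sum_mono) simp
    finally show ?thesis .
  qed
  then have "bounded (transport_polytope a b)" by (auto intro: boundedI)
  with cl show ?thesis by (simp add: compact_eq_bounded_closed)
qed

lemma sinkhorn_minimizer_ex1:
  assumes "0 < l" "a \<in> prob_simplex" "b \<in> prob_simplex"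
  shows "\<exists>!T. is_arg_min (sinkhorn_objective l M) (\<lambda>T. T \<in> transport_polytope a b) T"
proof -
  have "(\<chi> i j. a $ i * b $ j) \<in> transport_polytope a b"
    using assms
    by (simp add: mem_transport_polytope prob_simplex_def sum_distrib_left[symmetric]
        sum_distrib_right[symmetric])
  then have ne: "transport_polytope a b \<noteq> {}" by auto
  have "continuous_on (transport_polytope a b) (\<lambda>T. T $ i $ j * (ln (T $ i $ j) - 1))" for i j
    by (rule continuous_on_compose2[OF continuous_on_mult_ln])
      (auto intro!: continuous_intros simp: mem_transport_polytope)
  then have "continuous_on (transport_polytope a b) entropy"
    unfolding entropy_def by (intro continuous_on_minus continuous_on_sum)
  moreover have "continuous_on (transport_polytope a b) (\<lambda>T. frob_inner T M)"
    unfolding frob_inner_sum by (intro continuous_intros)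
  ultimately have cont: "continuous_on (transport_polytope a b) (sinkhorn_objective l M)"
    unfolding sinkhorn_objective_def
    by (intro continuous_on_diff continuous_on_mult continuous_on_const)
  obtain T where T: "T \<in> transport_polytope a b"
    "\<forall>U\<in>transport_polytope a b. sinkhorn_objective l M T \<le> sinkhorn_objective l M U"
    using continuous_attains_inf[OF compact_transport_polytope ne cont] by blast
  show ?thesis
  proof (rule ex1I[of _ T])
    show "is_arg_min (sinkhorn_objective l M) (\<lambda>T. T \<in> transport_polytope a b) T"
      using T by (auto simp: is_arg_min_linorder)
  next
    fix U assume U: "is_arg_min (sinkhorn_objective l M) (\<lambda>T. T \<in> transport_polytope a b) U"
    show "U = T"
    proof (rule ccontr)
      assume "U \<noteq> T"
      define V :: "real ^ 'a ^ 'a" where "V = (\<chi> i j. (U $ i $ j + T $ i $ j) / 2)"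
      have "2 * sinkhorn_objective l M V < sinkhorn_objective l M U + sinkhorn_objective l M T"
        unfolding V_def using \<open>U \<noteq> T\<close> U T assms
        by (intro sinkhorn_objective_midpoint) (auto simp: is_arg_min_def mem_transport_polytope)
      moreover have "V \<in> transport_polytope a b"
        using U T by (auto simp: V_def is_arg_min_def mem_transport_polytope sum.distrib
            sum_divide_distrib[symmetric])
      ultimately show False using U T by (fastforce simp: is_arg_min_linorder)
    qed
  qed
qed

lemma sinkhorn_plan_is_arg_min:
  assumes "0 < l" "a \<in> prob_simplex" "b \<in> prob_simplex"
  shows "is_arg_min (sinkhorn_objective l M) (\<lambda>T. T \<in> transport_polytope a b)
    (sinkhorn_plan l M a b)"
  unfolding sinkhorn_plan_def arg_min_on_def arg_min_def
  using sinkhorn_minimizer_ex1[OF assms] by (metis someI_ex)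

lemma regularized_sinkhorn_eq:
  assumes "0 < l" "a \<in> prob_simplex" "b \<in> prob_simplex"
  shows "regularized_sinkhorn l M a b = frob_inner (sinkhorn_plan l M a b) M
    - 1 / l * entropy (sinkhorn_plan l M a b)"
proof -
  have "regularized_sinkhorn l M a b = sinkhorn_objective l M (sinkhorn_plan l M a b)"
    unfolding regularized_sinkhorn_def
    using sinkhorn_plan_is_arg_min[OF assms]
    by (intro cInf_eq_minimum) (auto simp: is_arg_min_linorder)
  then show ?thesis by (simp add: sinkhorn_objective_def)
qed

lemma rel_interior_prob_simplex:
  "rel_interior (prob_simplex :: (real ^ 'n) set) = {q \<in> prob_simplex. \<forall>i. 0 < q $ i}"
proof
  let ?S = "prob_simplex :: (real ^ 'n) set"
  let ?c = "\<chi> i. 1 / real CARD('n) :: real ^ 'n"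
  have hull: "affine hull ?S \<subseteq> {q. (\<Sum>i\<in>UNIV. q $ i) = 1}"
  proof (rule hull_minimal)
    show "affine {q :: real ^ 'n. (\<Sum>i\<in>UNIV. q $ i) = 1}"
      by (auto simp: affine_def sum.distrib sum_distrib_left[symmetric])
  qed (auto simp: prob_simplex_def)
  have "convex ?S"
    by (auto simp: convex_def prob_simplex_def sum.distrib sum_distrib_left[symmetric])
  have c: "?c \<in> ?S" by (simp add: prob_simplex_def)
  show "rel_interior ?S \<subseteq> {q \<in> ?S. \<forall>i. 0 < q $ i}"
  proof clarify
    fix q assume q: "q \<in> rel_interior ?S"
    obtain e where e: "1 < e" "(1 - e) *\<^sub>R ?c + e *\<^sub>R q \<in> ?S"
      using convex_rel_interior_if[OF \<open>convex ?S\<close> q] c hull_subset[of ?S affine] by blast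
    have "0 < q $ i" for i
    proof -
      have "(e - 1) * (1 / real CARD('n)) \<le> e * q $ i"
      proof -
        have "0 \<le> ((1 - e) *\<^sub>R ?c + e *\<^sub>R q) $ i"
          using e(2) unfolding prob_simplex_def by blast
        then show ?thesis by (simp add: diff_divide_distrib algebra_simps)
      qed
      moreover have "0 < (e - 1) * (1 / real CARD('n))" using e(1) by simp
      ultimately show ?thesis using e(1) by (meson less_le_trans less_trans zero_less_mult_pos zero_less_one)
    qed
    then show "q \<in> ?S \<and> (\<forall>i. 0 < q $ i)" using q rel_interior_subset by blast
  qed
  show "{q \<in> ?S. \<forall>i. 0 < q $ i} \<subseteq> rel_interior ?S"
  proof clarify
    fix q :: "real ^ 'n" assume q: "q \<in> ?S" "\<forall>i. 0 < q $ i"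
    let ?T = "\<Inter>i. {q :: real ^ 'n. 0 < q $ i}"
    have "open ?T" by (intro open_INT ballI open_Collect_less continuous_intros) auto
    moreover have "?T \<inter> affine hull ?S \<subseteq> ?S"
      using hull by (auto simp: prob_simplex_def less_imp_le)
    ultimately show "q \<in> rel_interior ?S"
      unfolding rel_interior using q by blast
  qed
qed

lemma rel_interior_simplex_pairs:
  "rel_interior (prob_simplex \<times> prob_simplex :: ((real ^ 'n) \<times> (real ^ 'n)) set)
    = {(a, b). a \<in> prob_simplex \<and> b \<in> prob_simplex \<and> (\<forall>i. 0 < a $ i) \<and> (\<forall>i. 0 < b $ i)}"
proof -
  have "convex (prob_simplex :: (real ^ 'n) set)"
    by (auto simp: convex_def prob_simplex_def sum.distrib sum_distrib_left[symmetric])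
  then show ?thesis by (auto simp: rel_interior_Times rel_interior_prob_simplex)
qed

end

theory Submission
  imports Defs
begin

text \<open>
  The optimal plan has Gibbs form \<open>T i j = exp (u i + v j - l * M i j)\<close>. The pair \<open>z = (u, v)\<close> is only
  determined up to \<open>(u + t, v - t)\<close>; adding the rank-one term \<open>(s \<bullet> z) s\<close> along \<open>s = (1, -1)\<close> to the
  marginals of \<open>T\<close> gives a map \<open>F\<close> of \<open>z\<close> which is injective with everywhere invertible derivative,
  and which attains every pair of positive marginals, by minimising a coercive potential whose
  gradient is \<open>F z - (a, b)\<close>. The inverse function theorem then makes the dual variables differentiable
  functions of \<open>(a, b)\<close>. By Cramer's rule the algebra generated by the dual variables, the entries
  of \<open>T\<close> and \<open>1 / det DF\<close> is closed under directional derivatives, so all its members are smooth;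
  both distances belong to it.
\<close>

section \<open>Function algebras closed under differentiation\<close>

text \<open>Induction on the order, for all members of \<open>A\<close> at once: directional
  derivatives are again members, and differentiability gives continuity at order 0.\<close>

lemma smooth_on_coinduct:
  fixes S :: "'a::euclidean_space set"
  assumes step: "\<And>f. f \<in> A \<Longrightarrow>
      \<exists>f'. (\<forall>x\<in>S. (f has_derivative f' x) (at x within S)) \<and> (\<forall>v. (\<lambda>x. f' x v) \<in> A)"
    and "f \<in> A"
  shows "smooth_on f S"
proof -
  have "Ck_on k f S" if "f \<in> A" for k f
    using that
  proof (induction k arbitrary: f)
    case 0
    then show ?case
      using step[OF 0] by (auto intro: has_derivative_continuous_on)
  next
    case (Suc k)
    then show ?case
      using step[OF Suc.prems] by auto
  qed
  then show ?thesis
    using assms(2) by (simp add: smooth_on_def)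
qed

text \<open>Derivatives within \<open>S\<close> see only values on \<open>S\<close>, so a derivative
  of \<open>g\<close> also serves for \<open>f\<close>; a case split on the order suffices.\<close>

lemma smooth_on_cong:
  assumes "smooth_on g S" and "\<And>x. x \<in> S \<Longrightarrow> f x = g x"
  shows "smooth_on f S"
  unfolding smooth_on_def
proof
  fix k
  have "Ck_on k g S"
    using assms(1) by (simp add: smooth_on_def)
  then show "Ck_on k f S"
    using assms(2) by (cases k) (auto intro: continuous_on_eq has_derivative_transform)
qed

text \<open>The unital real algebra generated by \<open>B\<close>; rule induction reduces closure
  under differentiation to the generators.\<close>

inductive_set fun_algebra :: "('a \<Rightarrow> real) set \<Rightarrow> ('a \<Rightarrow> real) set" for B where
  const: "(\<lambda>x. r) \<in> fun_algebra B"
| gen: "f \<in> B \<Longrightarrow> f \<in> fun_algebra B"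
| add: "f \<in> fun_algebra B \<Longrightarrow> g \<in> fun_algebra B \<Longrightarrow> (\<lambda>x. f x + g x) \<in> fun_algebra B"
| mult: "f \<in> fun_algebra B \<Longrightarrow> g \<in> fun_algebra B \<Longrightarrow> (\<lambda>x. f x * g x) \<in> fun_algebra B"

lemma fun_algebra_mono: "B \<subseteq> C \<Longrightarrow> f \<in> fun_algebra B \<Longrightarrow> f \<in> fun_algebra C"
  by (rotate_tac, induction rule: fun_algebra.induct) (auto intro: fun_algebra.intros)

lemma fun_algebra_sum:
  assumes "\<And>i. i \<in> I \<Longrightarrow> f i \<in> fun_algebra B"
  shows "(\<lambda>x. \<Sum>i\<in>I. f i x) \<in> fun_algebra B"
  using assms by (induction I rule: infinite_finite_induct) (auto intro: fun_algebra.intros)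

lemma fun_algebra_prod:
  assumes "\<And>i. i \<in> I \<Longrightarrow> f i \<in> fun_algebra B"
  shows "(\<lambda>x. \<Prod>i\<in>I. f i x) \<in> fun_algebra B"
  using assms by (induction I rule: infinite_finite_induct) (auto intro: fun_algebra.intros)

lemma fun_algebra_diff:
  assumes "f \<in> fun_algebra B" "g \<in> fun_algebra B"
  shows "(\<lambda>x. f x - g x) \<in> fun_algebra B"
  using fun_algebra.add[OF assms(1) fun_algebra.mult[OF fun_algebra.const[of "-1"] assms(2)]]
  by simp

lemma fun_algebra_det:
  fixes A :: "'a \<Rightarrow> real ^ 'k ^ 'k"
  assumes "\<And>i j. (\<lambda>x. A x $ i $ j) \<in> fun_algebra B"
  shows "(\<lambda>x. det (A x)) \<in> fun_algebra B"
  unfolding det_def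
  by (intro fun_algebra_sum fun_algebra.mult fun_algebra.const fun_algebra_prod assms)

text \<open>Linearity and the product rule. \<open>C\<close> may exceed \<open>B\<close> so that
  derivatives can involve generators whose own derivatives are not yet known.\<close>

lemma fun_algebra_has_derivative:
  assumes gen: "\<And>g. g \<in> B \<Longrightarrow> \<exists>g'. (\<forall>x\<in>S. (g has_derivative g' x) (at x within S)) \<and>
      (\<forall>v. (\<lambda>x. g' x v) \<in> fun_algebra C)"
    and BC: "B \<subseteq> C" and f: "f \<in> fun_algebra B"
  shows "\<exists>f'. (\<forall>x\<in>S. (f has_derivative f' x) (at x within S)) \<and>
      (\<forall>v. (\<lambda>x. f' x v) \<in> fun_algebra C)"
  using f
proof induction
  case (const r)
  then show ?case
    by (intro exI[of _ "\<lambda>_ _. 0"]) (auto intro: fun_algebra.const)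
next
  case (gen f)
  then show ?case
    by (rule assms(1))
next
  case (add f g)
  then obtain f' g' where *:
    "\<forall>x\<in>S. (f has_derivative f' x) (at x within S)" "\<forall>v. (\<lambda>x. f' x v) \<in> fun_algebra C"
    "\<forall>x\<in>S. (g has_derivative g' x) (at x within S)" "\<forall>v. (\<lambda>x. g' x v) \<in> fun_algebra C"
    by blast
  show ?case
    by (intro exI[of _ "\<lambda>x v. f' x v + g' x v"])
      (use * in \<open>auto intro!: has_derivative_add fun_algebra.add\<close>)
next
  case (mult f g)
  then obtain f' g' where *:
    "\<forall>x\<in>S. (f has_derivative f' x) (at x within S)" "\<forall>v. (\<lambda>x. f' x v) \<in> fun_algebra C"
    "\<forall>x\<in>S. (g has_derivative g' x) (at x within S)" "\<forall>v. (\<lambda>x. g' x v) \<in> fun_algebra C"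
    by blast
  have "f \<in> fun_algebra C" "g \<in> fun_algebra C"
    using mult.hyps fun_algebra_mono[OF BC] by auto
  then show ?case
    by (intro exI[of _ "\<lambda>x v. f x * g' x v + f' x v * g x"])
      (use * in \<open>auto intro!: has_derivative_mult fun_algebra.add fun_algebra.mult\<close>)
qed

section \<open>Log-linear families: inverting the moment map\<close>

text \<open>A tangent of slope \<open>2 * \<alpha>\<close> handles \<open>w \<ge> 0\<close>;
  positivity of \<open>exp\<close> handles \<open>w \<le> 0\<close>.\<close>

lemma exp_minus_linear_coercive:
  fixes \<alpha> m :: real
  assumes "0 < \<alpha>"
  shows "\<exists>C. \<forall>w. \<alpha> * \<bar>w\<bar> - C \<le> exp (w - m) - \<alpha> * w"
proof (intro exI allI)
  fix w
  \<comment> \<open>The slope of \<open>exp (w - m)\<close> equals \<open>2 * \<alpha>\<close> at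
    \<open>w = m + t\<close>.\<close>
  define t where "t = ln (2 * \<alpha>)"
  have "1 + (w - m - t) \<le> exp (w - m - t)"
    by (rule exp_ge_add_one_self)
  then have "2 * \<alpha> * (1 + (w - m - t)) \<le> 2 * \<alpha> * exp (w - m - t)"
    using assms by simp
  also have "\<dots> = exp (w - m)"
    using assms by (simp add: t_def exp_diff)
  finally have "2 * \<alpha> * w - 2 * \<alpha> * (m + t - 1) \<le> exp (w - m)"
    by (simp add: algebra_simps)
  moreover have "2 * \<alpha> * (m + t - 1) \<le> \<bar>2 * \<alpha> * (m + t - 1)\<bar>"
    by simp
  moreover have "0 \<le> exp (w - m)"
    by simp
  moreover have "\<alpha> * \<bar>w\<bar> = \<alpha> * w \<or> \<alpha> * \<bar>w\<bar> = - (\<alpha> * w)"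
    by (simp add: abs_if)
  ultimately show "\<alpha> * \<bar>w\<bar> - \<bar>2 * \<alpha> * (m + t - 1)\<bar> \<le> exp (w - m) - \<alpha> * w"
    by linarith
qed

text \<open>The vector \<open>s\<close> spans the directions along which all weights \<open>exp (c p \<bullet> z - m p)\<close> are constant.\<close>
locale log_linear =
  fixes c :: "'p::finite \<Rightarrow> real ^ 'k" and m :: "'p \<Rightarrow> real" and s :: "real ^ 'k"
  assumes total: "\<And>z. (\<And>p. c p \<bullet> z = 0) \<Longrightarrow> s \<bullet> z = 0 \<Longrightarrow> z = 0"
    and orth: "\<And>p. c p \<bullet> s = 0"
begin

definition weight :: "real ^ 'k \<Rightarrow> 'p \<Rightarrow> real" where
  "weight z p = exp (c p \<bullet> z - m p)"

text \<open>The map \<open>F\<close> of the overview. Moving along \<open>s\<close> changes no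
  weight; the last summand detects that direction.\<close>

definition moment :: "real ^ 'k \<Rightarrow> real ^ 'k" where
  "moment z = (\<Sum>p\<in>UNIV. weight z p *\<^sub>R c p) + (s \<bullet> z) *\<^sub>R s"

text \<open>The Jacobian matrix of \<open>moment\<close>.\<close>

definition hess :: "real ^ 'k \<Rightarrow> real ^ 'k ^ 'k" where
  "hess z = (\<chi> i j. (\<Sum>p\<in>UNIV. weight z p * (c p $ i * c p $ j)) + s $ i * s $ j)"

text \<open>A true inverse on the range of \<open>moment\<close>, by injectivity; elsewhere its
  value is arbitrary.\<close>

definition dual :: "real ^ 'k \<Rightarrow> real ^ 'k" where
  "dual = inv moment"

lemma hess_mult:
  "hess z *v h = (\<Sum>p\<in>UNIV. (weight z p * (c p \<bullet> h)) *\<^sub>R c p) + (s \<bullet> h) *\<^sub>R s"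
proof -
  have "(\<Sum>j\<in>UNIV. (\<Sum>p\<in>UNIV. weight z p * (c p $ i * c p $ j)) * h $ j)
      = (\<Sum>p\<in>UNIV. (weight z p * (\<Sum>j\<in>UNIV. c p $ j * h $ j)) * c p $ i)" for i
    unfolding sum_distrib_right sum_distrib_left
    by (subst sum.swap) (simp add: mult_ac)
  then show ?thesis
    by (simp add: vec_eq_iff hess_def matrix_vector_mult_def inner_vec_def algebra_simps
        sum.distrib sum_distrib_left sum_distrib_right)
qed

text \<open>The quadratic form of \<open>hess z\<close> is a positive combination of squares; a
  kernel vector is thus orthogonal to \<open>s\<close> and every \<open>c p\<close>, and
  \<open>total\<close> makes it zero.\<close>

lemma det_hess_nonzero: "det (hess z) \<noteq> 0"
proof -
  have "h = 0" if "hess z *v h = 0" for h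
  proof -
    have "0 = h \<bullet> (hess z *v h)"
      using that by simp
    also have "\<dots> = (\<Sum>p\<in>UNIV. weight z p * (c p \<bullet> h)\<^sup>2) + (s \<bullet> h)\<^sup>2"
      by (simp add: hess_mult inner_add_right inner_sum_right power2_eq_square inner_commute mult_ac)
    finally have eq: "(\<Sum>p\<in>UNIV. weight z p * (c p \<bullet> h)\<^sup>2) + (s \<bullet> h)\<^sup>2 = 0" ..
    moreover have nn: "0 \<le> (\<Sum>p\<in>UNIV. weight z p * (c p \<bullet> h)\<^sup>2)"
      by (intro sum_nonneg) (simp add: weight_def)
    ultimately have "(s \<bullet> h)\<^sup>2 = 0" "(\<Sum>p\<in>UNIV. weight z p * (c p \<bullet> h)\<^sup>2) = 0"
      by (smt (verit) zero_le_power2)+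
    then show "h = 0"
      by (intro total) (auto simp: sum_nonneg_eq_0_iff weight_def)
  qed
  then show ?thesis
    by (metis invertible_det_nz invertible_left_inverse matrix_left_invertible_ker)
qed

text \<open>Monotonicity: pairing \<open>moment z - moment z'\<close> with \<open>z - z'\<close>
  gives nonnegative terms because \<open>exp\<close> is increasing. All of them vanish, and
  \<open>total\<close> applies.\<close>

lemma inj_moment: "inj moment"
proof (rule injI)
  fix z z' assume "moment z = moment z'"
  then have "0 = (z - z') \<bullet> (moment z - moment z')"
    by simp
  also have "\<dots> = (\<Sum>p\<in>UNIV. (weight z p - weight z' p) * (c p \<bullet> z - c p \<bullet> z'))
      + (s \<bullet> z - s \<bullet> z')\<^sup>2"
    by (simp add: moment_def inner_diff_right inner_diff_left inner_add_right inner_sum_right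
        inner_commute sum_subtractf[symmetric] power2_eq_square algebra_simps sum.distrib)
  finally have eq: "(\<Sum>p\<in>UNIV. (weight z p - weight z' p) * (c p \<bullet> z - c p \<bullet> z'))
      + (s \<bullet> z - s \<bullet> z')\<^sup>2 = 0" ..
  have nn: "0 \<le> (weight z p - weight z' p) * (c p \<bullet> z - c p \<bullet> z')" for p
    by (cases "c p \<bullet> z \<le> c p \<bullet> z'")
      (auto simp: weight_def zero_le_mult_iff)
  have "(s \<bullet> z - s \<bullet> z')\<^sup>2 = 0"
    "(\<Sum>p\<in>UNIV. (weight z p - weight z' p) * (c p \<bullet> z - c p \<bullet> z')) = 0"
    using eq nn by (smt (verit) zero_le_power2 sum_nonneg)+
  then have "s \<bullet> (z - z') = 0" "c p \<bullet> (z - z') = 0" for p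
    using nn by (auto simp: sum_nonneg_eq_0_iff weight_def inner_diff_right)
  then show "z = z'"
    using total[of "z - z'"] by simp
qed

lemma moment_has_derivative: "(moment has_derivative (\<lambda>h. hess z *v h)) (at z)"
  unfolding moment_def[abs_def] weight_def hess_mult
  by (auto intro!: derivative_eq_intros simp: mult.commute)

text \<open>By \<open>total\<close> the linear map \<open>L\<close> is injective, hence bounded
  below in finite dimension; the right-hand side dominates its norm.\<close>

lemma coercive_lower_bound:
  assumes "\<And>p. 0 < \<alpha> p"
  shows "\<exists>B>0. \<forall>z. B * norm z \<le> (\<Sum>p\<in>UNIV. \<alpha> p * \<bar>c p \<bullet> z\<bar>) + \<bar>s \<bullet> z\<bar>"
proof -
  define L where "L z = ((\<chi> p. \<alpha> p * (c p \<bullet> z)) :: real ^ 'p, s \<bullet> z)" for z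
  have "linear L"
    by (rule linearI) (auto simp: L_def vec_eq_iff algebra_simps)
  moreover have "z = 0" if "L z = 0" for z
    using that assms
    by (intro total) (auto simp: L_def vec_eq_iff zero_prod_def less_imp_neq[symmetric])
  ultimately obtain B where B: "B > 0" "\<And>z. B * norm z \<le> norm (L z)"
    using linear_inj_bounded_below_pos[of L] linear_injective_0[of L] by blast
  have "norm (L z) \<le> (\<Sum>p\<in>UNIV. \<alpha> p * \<bar>c p \<bullet> z\<bar>) + \<bar>s \<bullet> z\<bar>" for z
  proof -
    have "norm (L z) \<le> norm (\<chi> p. \<alpha> p * (c p \<bullet> z)) + norm (s \<bullet> z)"
      unfolding L_def by (rule norm_Pair_le)
    also have "norm (\<chi> p. \<alpha> p * (c p \<bullet> z)) \<le> (\<Sum>p\<in>UNIV. \<bar>(\<chi> p. \<alpha> p * (c p \<bullet> z)) $ p\<bar>)"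
      by (rule norm_le_l1_cart)
    also have "\<dots> = (\<Sum>p\<in>UNIV. \<alpha> p * \<bar>c p \<bullet> z\<bar>)"
      using assms by (simp add: abs_mult less_imp_le)
    finally show ?thesis
      by simp
  qed
  then show ?thesis
    using B by (meson order_trans)
qed

text \<open>Coercivity of \<open>\<Psi>\<close> gives a global minimiser, whose first-order
  condition is the required moment equation.\<close>

lemma positive_combination_in_range:
  assumes \<alpha>: "\<And>p. 0 < \<alpha> p"
  shows "(\<Sum>p\<in>UNIV. \<alpha> p *\<^sub>R c p) \<in> range moment"
proof -
  \<comment> \<open>The gradient of \<open>\<Psi>\<close> at \<open>z\<close> is \<open>moment z\<close> minus the given combination.\<close>
  define \<Psi> where "\<Psi> z = (\<Sum>p\<in>UNIV. weight z p - \<alpha> p * (c p \<bullet> z)) + (s \<bullet> z)\<^sup>2 / 2" for z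
  obtain B where B: "B > 0"
    "\<And>z. B * norm z \<le> (\<Sum>p\<in>UNIV. \<alpha> p * \<bar>c p \<bullet> z\<bar>) + \<bar>s \<bullet> z\<bar>"
    using coercive_lower_bound[of \<alpha>] \<alpha> by blast
  have "\<forall>p. \<exists>C. \<forall>w. \<alpha> p * \<bar>w\<bar> - C \<le> exp (w - m p) - \<alpha> p * w"
    using exp_minus_linear_coercive \<alpha> by blast
  then obtain C where C: "\<And>p w. \<alpha> p * \<bar>w\<bar> - C p \<le> exp (w - m p) - \<alpha> p * w"
    by metis
  have low: "B * norm z - (sum C UNIV + 1) \<le> \<Psi> z" for z
  proof -
    have "(\<Sum>p\<in>UNIV. \<alpha> p * \<bar>c p \<bullet> z\<bar> - C p) \<le> (\<Sum>p\<in>UNIV. weight z p - \<alpha> p * (c p \<bullet> z))"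
      unfolding weight_def by (intro sum_mono C)
    \<comment> \<open>The square trades the quadratic penalty for the linear term in
      \<open>s\<close> of the coercivity bound, at the cost of a constant.\<close>
    moreover have "0 \<le> (\<bar>s \<bullet> z\<bar> - 1)\<^sup>2"
      by simp
    then have "\<bar>s \<bullet> z\<bar> - 1 \<le> (s \<bullet> z)\<^sup>2 / 2"
      by (simp add: power2_diff)
    ultimately show ?thesis
      using B(2)[of z] by (simp add: \<Psi>_def sum_subtractf)
  qed
  have cont: "continuous_on UNIV \<Psi>"
    unfolding \<Psi>_def weight_def by (intro continuous_intros) auto
  \<comment> \<open>By \<open>low\<close>, the sublevel set of \<open>\<Psi>\<close> at level
    \<open>\<Psi> 0\<close> lies in the ball of radius \<open>R\<close>, so a minimum over the ball
    is global.\<close>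
  define R where "R = (\<Psi> 0 + sum C UNIV + 1) / B"
  have "norm z \<le> R" if "\<Psi> z \<le> \<Psi> 0" for z
    using low[of z] that B(1) by (simp add: R_def field_simps)
  then have sub: "{z. \<Psi> z \<le> \<Psi> 0} \<subseteq> cball 0 R"
    by auto
  then have "0 \<in> cball (0 :: real ^ 'k) R"
    by auto
  then obtain z where z: "z \<in> cball 0 R" "\<And>y. y \<in> cball 0 R \<Longrightarrow> \<Psi> z \<le> \<Psi> y"
    using continuous_attains_inf[of "cball 0 R" \<Psi>] continuous_on_subset[OF cont]
    by (metis compact_cball empty_iff subset_UNIV)
  have min: "\<Psi> z \<le> \<Psi> y" for y
  proof (cases "\<Psi> y \<le> \<Psi> 0")
    case True
    then show ?thesis
      using sub by (intro z(2)) auto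
  next
    case False
    then show ?thesis
      using z(2)[of 0] \<open>0 \<in> cball 0 R\<close> by simp
  qed
  have "(\<Psi> has_derivative (\<lambda>h. (moment z - (\<Sum>p\<in>UNIV. \<alpha> p *\<^sub>R c p)) \<bullet> h)) (at z)"
    unfolding \<Psi>_def[abs_def] weight_def moment_def
    by (auto intro!: derivative_eq_intros simp: fun_eq_iff inner_diff_left inner_add_left
        inner_sum_left sum_subtractf algebra_simps)
  then have "(\<lambda>h. (moment z - (\<Sum>p\<in>UNIV. \<alpha> p *\<^sub>R c p)) \<bullet> h) = (\<lambda>h. 0)"
    using min by (intro differential_zero_maxmin[of z UNIV \<Psi>]) auto
  then have "moment z - (\<Sum>p\<in>UNIV. \<alpha> p *\<^sub>R c p) = 0"
    by (metis inner_eq_zero_iff)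
  then show ?thesis
    by (intro image_eqI[of _ _ z]) auto
qed

lemma moment_dual:
  assumes "\<And>p. 0 < \<alpha> p"
  shows "moment (dual (\<Sum>p\<in>UNIV. \<alpha> p *\<^sub>R c p)) = (\<Sum>p\<in>UNIV. \<alpha> p *\<^sub>R c p)"
  unfolding dual_def by (intro f_inv_into_f positive_combination_in_range assms)

text \<open>By \<open>orth\<close>, pairing the moment equation with \<open>s\<close> leaves
  \<open>(s \<bullet> z) * (s \<bullet> s) = 0\<close>: the correction vanishes, and the weights
  alone reproduce the target.\<close>

lemma weights_dual:
  assumes "\<And>p. 0 < \<alpha> p"
  shows "(\<Sum>p\<in>UNIV. weight (dual (\<Sum>p\<in>UNIV. \<alpha> p *\<^sub>R c p)) p *\<^sub>R c p) = (\<Sum>p\<in>UNIV. \<alpha> p *\<^sub>R c p)"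
proof -
  define z where "z = dual (\<Sum>p\<in>UNIV. \<alpha> p *\<^sub>R c p)"
  have eq: "(\<Sum>p\<in>UNIV. weight z p *\<^sub>R c p) + (s \<bullet> z) *\<^sub>R s = (\<Sum>p\<in>UNIV. \<alpha> p *\<^sub>R c p)"
    using moment_dual[of \<alpha>] assms by (simp add: z_def moment_def)
  then have "((\<Sum>p\<in>UNIV. weight z p *\<^sub>R c p) + (s \<bullet> z) *\<^sub>R s) \<bullet> s = (\<Sum>p\<in>UNIV. \<alpha> p *\<^sub>R c p) \<bullet> s"
    by simp
  then have "(s \<bullet> z) * (s \<bullet> s) = 0"
    by (simp add: inner_add_left inner_sum_left orth)
  then have "(s \<bullet> z) *\<^sub>R s = 0"
    by auto
  then show ?thesis
    using eq by (simp only: z_def add_0_right)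
qed

text \<open>The inverse function theorem. Cramer's rule makes the derivative polynomial in the
  entries of \<open>hess z\<close> and the reciprocal determinant.\<close>

lemma dual_has_derivative:
  "(dual has_derivative
     (\<lambda>w. \<chi> k. det (\<chi> i j. if j = k then w $ i else hess z $ i $ j) * inverse (det (hess z))))
   (at (moment z))"
proof (rule has_derivative_inverse_strong[where S = UNIV and x = z and f = moment])
  show "continuous_on UNIV moment"
    by (rule has_derivative_continuous_on) (rule moment_has_derivative)
  show "(*v) (hess z) \<circ>
      (\<lambda>w. \<chi> k. det (\<chi> i j. if j = k then w $ i else hess z $ i $ j) * inverse (det (hess z))) = id"
    by (simp add: fun_eq_iff cramer[OF det_hess_nonzero] divide_inverse)
qed (use inj_moment moment_has_derivative in \<open>auto simp: dual_def\<close>)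

text \<open>The reciprocal determinant is kept apart: the determinant is a polynomial in the
  weights, so it can be differentiated first.\<close>

inductive_set basic_generators :: "('a::euclidean_space \<Rightarrow> real ^ 'k) \<Rightarrow> ('a \<Rightarrow> real) set"
  for J where
  coord: "(\<lambda>x. dual (J x) $ k) \<in> basic_generators J"
| weight: "(\<lambda>x. weight (dual (J x)) p) \<in> basic_generators J"

abbreviation generators :: "('a::euclidean_space \<Rightarrow> real ^ 'k) \<Rightarrow> ('a \<Rightarrow> real) set" where
  "generators J \<equiv> insert (\<lambda>x. inverse (det (hess (dual (J x))))) (basic_generators J)"

text \<open>Each generator has its derivatives in the algebra: by Cramer's rule for coordinates, the
  chain rule for weights, the reciprocal rule for the inverse determinant. The condition on
  \<open>S\<close> keeps \<open>J x\<close> in the range of \<open>moment\<close>.\<close>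

lemma smooth_on_fun_algebra_generators:
  fixes J :: "'a::euclidean_space \<Rightarrow> real ^ 'k"
  assumes J: "linear J"
    and S: "\<And>x. x \<in> S \<Longrightarrow> \<exists>\<alpha>. (\<forall>p. 0 < \<alpha> p) \<and> J x = (\<Sum>p\<in>UNIV. \<alpha> p *\<^sub>R c p)"
    and f: "f \<in> fun_algebra (generators J)"
  shows "smooth_on f S"
proof -
  let ?A = "fun_algebra (generators J)"
  define z' where "z' x v = (\<chi> k. det (\<chi> i j. if j = k then J v $ i else hess (dual (J x)) $ i $ j)
      * inverse (det (hess (dual (J x)))))" for x v
  have deriv: "((\<lambda>x. dual (J x)) has_derivative z' x) (at x within S)" if "x \<in> S" for x
  proof -
    have "moment (dual (J x)) = J x"
      using S[OF that] moment_dual by auto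
    then have "(dual has_derivative (\<lambda>w. \<chi> k. det (\<chi> i j. if j = k then w $ i
        else hess (dual (J x)) $ i $ j) * inverse (det (hess (dual (J x)))))) (at (J x))"
      using dual_has_derivative[of "dual (J x)"] by simp
    from has_derivative_compose[OF linear_imp_has_derivative[OF J] this]
    show ?thesis
      by (simp add: z'_def[abs_def])
  qed
  have w: "(\<lambda>x. weight (dual (J x)) p) \<in> fun_algebra (basic_generators J)" for p
    by (intro fun_algebra.gen basic_generators.weight)
  have hess: "(\<lambda>x. hess (dual (J x)) $ i $ j) \<in> fun_algebra (basic_generators J)" for i j
    unfolding hess_def
    by (auto intro!: fun_algebra.intros(1,3,4) fun_algebra_sum w)
  have basic: "g \<in> ?A" if "g \<in> fun_algebra (basic_generators J)" for g
    using fun_algebra_mono[OF subset_insertI that] .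
  have z'A: "(\<lambda>x. z' x v $ k) \<in> ?A" for v k
    unfolding z'_def vec_lambda_beta
  proof (intro fun_algebra.mult fun_algebra_det)
    fix i j
    show "(\<lambda>x. (\<chi> i j. if j = k then J v $ i else hess (dual (J x)) $ i $ j) $ i $ j) \<in> ?A"
      using basic[OF hess] by (cases "j = k") (auto intro: fun_algebra.const)
  qed (auto intro: fun_algebra.gen)
  have basic_step: "\<exists>g'. (\<forall>x\<in>S. (g has_derivative g' x) (at x within S)) \<and> (\<forall>v. (\<lambda>x. g' x v) \<in> ?A)"
    if "g \<in> basic_generators J" for g
    using that
  proof cases
    case (coord k)
    show ?thesis
      unfolding coord
      by (intro exI[of _ "\<lambda>x v. z' x v $ k"] conjI allI ballI z'A
          bounded_linear.has_derivative[OF bounded_linear_vec_nth] deriv)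
  next
    case (weight p)
    show ?thesis
      unfolding weight
    proof (intro exI[of _ "\<lambda>x v. weight (dual (J x)) p * (c p \<bullet> z' x v)"] conjI allI ballI)
      fix x assume "x \<in> S"
      show "((\<lambda>x. weight (dual (J x)) p) has_derivative
          (\<lambda>v. weight (dual (J x)) p * (c p \<bullet> z' x v))) (at x within S)"
        unfolding weight_def
        by (auto intro!: derivative_eq_intros deriv \<open>x \<in> S\<close>)
    next
      fix v
      show "(\<lambda>x. weight (dual (J x)) p * (c p \<bullet> z' x v)) \<in> ?A"
        unfolding inner_vec_def inner_real_def
        by (intro fun_algebra.mult fun_algebra_sum fun_algebra.const z'A basic[OF w])
    qed
  qed
  \<comment> \<open>The basic generators suffice to differentiate the determinant; \<open>D\<close>
    then yields the derivative of its reciprocal.\<close>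
  have "\<exists>D. (\<forall>x\<in>S. ((\<lambda>x. det (hess (dual (J x)))) has_derivative D x) (at x within S)) \<and>
      (\<forall>v. (\<lambda>x. D x v) \<in> ?A)"
    by (rule fun_algebra_has_derivative[OF basic_step subset_insertI fun_algebra_det[OF hess]])
  then obtain D where D:
    "\<And>x. x \<in> S \<Longrightarrow> ((\<lambda>x. det (hess (dual (J x)))) has_derivative D x) (at x within S)"
    "\<And>v. (\<lambda>x. D x v) \<in> ?A"
    by blast
  let ?i = "\<lambda>x. inverse (det (hess (dual (J x))))"
  have step: "\<exists>g'. (\<forall>x\<in>S. (g has_derivative g' x) (at x within S)) \<and> (\<forall>v. (\<lambda>x. g' x v) \<in> ?A)"
    if "g \<in> generators J" for g
    using that
  proof
    assume g: "g = ?i"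
    show ?thesis
      unfolding g
    proof (intro exI[of _ "\<lambda>x v. -1 * (?i x * D x v * ?i x)"] conjI allI ballI)
      fix x assume "x \<in> S"
      show "(?i has_derivative (\<lambda>v. -1 * (?i x * D x v * ?i x))) (at x within S)"
        using Deriv.has_derivative_inverse[OF det_hess_nonzero D(1)[OF \<open>x \<in> S\<close>]] by simp
    next
      fix v
      show "(\<lambda>x. -1 * (?i x * D x v * ?i x)) \<in> ?A"
        by (intro fun_algebra.mult fun_algebra.const D(2)) (auto intro: fun_algebra.gen)
    qed
  qed (rule basic_step)
  show ?thesis
    by (rule smooth_on_coinduct[of ?A, OF fun_algebra_has_derivative[OF step order_refl] f])
qed

end

section \<open>Gibbs plans and transport marginals\<close>

text \<open>\<open>u\<close> and \<open>v\<close> are Lagrange multipliers of the marginal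
  constraints; convexity makes this first-order condition sufficient, and the minimiser is
  unique.\<close>

lemma sinkhorn_plan_eqI:
  fixes T M :: "real ^ 'n ^ 'n"
  assumes l: "0 < l" and ab: "a \<in> prob_simplex" "b \<in> prob_simplex"
    and T: "T \<in> transport_polytope a b"
    and gibbs: "\<And>i j. T $ i $ j = exp (u i + v j - l * M $ i $ j)"
  shows "sinkhorn_plan l M a b = T"
proof -
  have "sinkhorn_objective l M T \<le> sinkhorn_objective l M U" if U: "U \<in> transport_polytope a b" for U
  proof -
    have marg: "(\<Sum>j\<in>UNIV. T $ i $ j) = (\<Sum>j\<in>UNIV. U $ i $ j)"
      "(\<Sum>i\<in>UNIV. T $ i $ j) = (\<Sum>i\<in>UNIV. U $ i $ j)" for i j
      using T U by (simp_all add: mem_transport_polytope)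
    \<comment> \<open>A function \<open>u i + v j\<close> is summed through the marginals alone,
      which agree for \<open>T\<close> and \<open>U\<close>.\<close>
    have "(\<Sum>i\<in>UNIV. \<Sum>j\<in>UNIV. (U $ i $ j - T $ i $ j) * (u i + v j))
        = (\<Sum>i\<in>UNIV. u i * (\<Sum>j\<in>UNIV. U $ i $ j - T $ i $ j))
        + (\<Sum>j\<in>UNIV. v j * (\<Sum>i\<in>UNIV. U $ i $ j - T $ i $ j))"
      unfolding sum_distrib_left
      by (subst (3) sum.swap) (simp add: sum.distrib[symmetric] algebra_simps)
    then have zero: "(\<Sum>i\<in>UNIV. \<Sum>j\<in>UNIV. (U $ i $ j - T $ i $ j) * (u i + v j)) = 0"
      by (simp add: sum_subtractf marg)
    \<comment> \<open>The tangent inequality at the positive entry of \<open>T\<close>; the Gibbs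
      form turns the slope \<open>ln (T $ i $ j) + l * M $ i $ j\<close> into
      \<open>u i + v j\<close>.\<close>
    have "(U $ i $ j - T $ i $ j) * (u i + v j)
        \<le> (l * (U $ i $ j * M $ i $ j) + U $ i $ j * (ln (U $ i $ j) - 1))
        - (l * (T $ i $ j * M $ i $ j) + T $ i $ j * (ln (T $ i $ j) - 1))" for i j
    proof -
      have "U $ i $ j - T $ i $ j \<le> U $ i $ j * ln (U $ i $ j) - U $ i $ j * ln (T $ i $ j)"
        using U gibbs[of i j] by (intro entropy_tangent(1)) (auto simp: mem_transport_polytope)
      moreover have ln: "ln (T $ i $ j) = u i + v j - l * M $ i $ j"
        by (simp add: gibbs)
      ultimately show ?thesis
        unfolding ln by (simp add: algebra_simps)
    qed
    then have "(\<Sum>i\<in>UNIV. \<Sum>j\<in>UNIV. (U $ i $ j - T $ i $ j) * (u i + v j))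
        \<le> (\<Sum>i\<in>UNIV. \<Sum>j\<in>UNIV.
          (l * (U $ i $ j * M $ i $ j) + U $ i $ j * (ln (U $ i $ j) - 1))
        - (l * (T $ i $ j * M $ i $ j) + T $ i $ j * (ln (T $ i $ j) - 1)))"
      by (intro sum_mono)
    moreover have scaled: "l * sinkhorn_objective l M V = (\<Sum>i\<in>UNIV. \<Sum>j\<in>UNIV.
        l * (V $ i $ j * M $ i $ j) + V $ i $ j * (ln (V $ i $ j) - 1))" for V
      unfolding sinkhorn_objective_def frob_inner_sum entropy_def
      using l by (subst sum.swap) (simp add: sum.distrib sum_subtractf sum_distrib_left algebra_simps)
    ultimately have "l * sinkhorn_objective l M T \<le> l * sinkhorn_objective l M U"
      unfolding scaled zero by (simp add: sum_subtractf)
    then show ?thesis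
      using l by simp
  qed
  then have "is_arg_min (sinkhorn_objective l M) (\<lambda>T. T \<in> transport_polytope a b) T"
    using T by (auto simp: is_arg_min_linorder)
  then show ?thesis
    using sinkhorn_minimizer_ex1[OF l ab] sinkhorn_plan_is_arg_min[OF l ab] by blast
qed

text \<open>Incidence vectors of the complete bipartite graph on rows \<open>Inl\<close> and columns
  \<open>Inr\<close>; weighted sums of them are pairs of marginals.\<close>

definition edge :: "'n \<times> 'n \<Rightarrow> real ^ ('n + 'n::finite)" where
  "edge p = axis (Inl (fst p)) 1 + axis (Inr (snd p)) 1"

definition gauge :: "real ^ ('n + 'n::finite)" where
  "gauge = (\<chi> k. case k of Inl _ \<Rightarrow> 1 | Inr _ \<Rightarrow> -1)"

text \<open>A single index type makes the Jacobian a square matrix with a determinant.\<close>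

definition join_vec :: "(real ^ 'n) \<times> (real ^ 'n) \<Rightarrow> real ^ ('n + 'n::finite)" where
  "join_vec x = (\<chi> k. case k of Inl i \<Rightarrow> fst x $ i | Inr j \<Rightarrow> snd x $ j)"

lemma edge_inner: "edge (i, j) \<bullet> z = z $ Inl i + z $ Inr j"
  by (simp add: edge_def inner_add_left inner_axis')

text \<open>Orthogonality to all edges forces the value \<open>t\<close> on rows and
  \<open>- t\<close> on columns; pairing with \<open>gauge\<close> gives a positive multiple of
  \<open>t\<close>.\<close>

lemma log_linear_edge: "log_linear (edge :: 'n \<times> 'n \<Rightarrow> real ^ ('n + 'n::finite)) gauge"
proof
  fix p :: "'n \<times> 'n"
  show "edge p \<bullet> gauge = 0"
    by (cases p) (simp add: edge_inner gauge_def)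
next
  fix z :: "real ^ ('n + 'n)"
  assume e: "\<And>p. edge p \<bullet> z = 0" and g: "gauge \<bullet> z = 0"
  have ij: "z $ Inl i = - z $ Inr j" for i j
    using e[of "(i, j)"] by (simp add: edge_inner)
  \<comment> \<open>\<open>undefined\<close> stands for an arbitrary index.\<close>
  define t where "t = z $ Inl undefined"
  have r: "z $ Inr j = - t" for j
    using ij[of undefined j] by (simp add: t_def)
  have t: "z $ Inl i = t" for i
    using ij[of i undefined] r by simp
  have "0 = (\<Sum>k\<in>UNIV. gauge $ k * z $ k)"
    using g by (simp add: inner_vec_def)
  also have "\<dots> = (\<Sum>k\<in>(UNIV :: ('n + 'n) set). t)"
    by (intro sum.cong refl) (auto simp: gauge_def t r split: sum.split)
  finally have "t = 0"
    by simp
  then show "z = 0"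
    using t r by (simp add: vec_eq_iff split_sum_all)
qed

lemma sum_edge:
  fixes w :: "'n::finite \<times> 'n \<Rightarrow> real"
  shows "(\<Sum>p\<in>UNIV. w p *\<^sub>R edge p)
    = join_vec (\<chi> i. \<Sum>j\<in>UNIV. w (i, j), \<chi> j. \<Sum>i\<in>UNIV. w (i, j))"
proof -
  have "(\<Sum>p\<in>UNIV. w p * edge p $ Inl i) = (\<Sum>j\<in>UNIV. w (i, j))" for i
    unfolding UNIV_Times_UNIV[symmetric] sum.cartesian_product'
    by (subst sum.swap) (simp add: edge_def axis_def if_distrib[of "(*) _"] cong: if_cong)
  moreover have "(\<Sum>p\<in>UNIV. w p * edge p $ Inr j) = (\<Sum>i\<in>UNIV. w (i, j))" for j
    unfolding UNIV_Times_UNIV[symmetric] sum.cartesian_product'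
    by (simp add: edge_def axis_def if_distrib[of "(*) _"] cong: if_cong)
  ultimately show ?thesis
    by (simp add: vec_eq_iff join_vec_def split_sum_all)
qed

theorem theorem2:
  fixes X :: "'x set" and d :: "'x \<Rightarrow> 'x \<Rightarrow> real"
    and x y :: "'n::finite \<Rightarrow> 'x" and p l :: real
  assumes "Metric_space X d"
    and "\<And>i. x i \<in> X" and "\<And>i. y i \<in> X"
    and "p \<ge> 1" and "l > 0"
  shows "smooth_on (\<lambda>(a, b). regularized_sinkhorn l (cost_matrix d p x y) a b)
           (rel_interior (prob_simplex \<times> prob_simplex)) \<and>
         smooth_on (\<lambda>(a, b). sharp_sinkhorn l (cost_matrix d p x y) a b)
           (rel_interior (prob_simplex \<times> prob_simplex))"
proof -
  define M where "M = cost_matrix d p x y"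
  define S where "S = (rel_interior (prob_simplex \<times> prob_simplex) :: ((real ^ 'n) \<times> (real ^ 'n)) set)"
  \<comment> \<open>The cost enters as the offset, so the weights are the Gibbs entries
    \<open>exp (u i + v j - l * M $ i $ j)\<close>.\<close>
  interpret log_linear edge "\<lambda>(i, j). l * M $ i $ j" gauge
    by (rule log_linear_edge)
  define z where "z w = dual (join_vec w)" for w
  define T where "T w = (\<chi> i j. weight (z w) (i, j))" for w
  let ?A = "fun_algebra (generators join_vec)"
  have join: "linear (join_vec :: (real ^ 'n) \<times> (real ^ 'n) \<Rightarrow> _)"
    by (rule linearI) (auto simp: join_vec_def vec_eq_iff split: sum.split)
  have combination: "\<exists>\<alpha>. (\<forall>p. 0 < \<alpha> p) \<and> join_vec w = (\<Sum>p\<in>UNIV. \<alpha> p *\<^sub>R edge p)"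
    if "w \<in> S" for w
  proof -
    have "(\<Sum>i\<in>UNIV. fst w $ i) = 1" "(\<Sum>i\<in>UNIV. snd w $ i) = 1"
      "\<forall>i. 0 < fst w $ i" "\<forall>i. 0 < snd w $ i"
      using that unfolding S_def rel_interior_simplex_pairs by (auto simp: prob_simplex_def)
    \<comment> \<open>The independent coupling is positive and has these marginals, as both masses
      are one.\<close>
    then show ?thesis
      by (intro exI[of _ "\<lambda>p. fst w $ fst p * snd w $ snd p"])
        (simp add: sum_edge sum_distrib_left[symmetric] sum_distrib_right[symmetric])
  qed
  have plan: "sinkhorn_plan l M a b = T (a, b)" if w: "(a, b) \<in> S" for a b
  proof (rule sinkhorn_plan_eqI[OF \<open>l > 0\<close>,
        where u = "\<lambda>i. z (a, b) $ Inl i" and v = "\<lambda>j. z (a, b) $ Inr j"])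
    show "a \<in> prob_simplex" "b \<in> prob_simplex"
      using w by (auto simp: S_def rel_interior_simplex_pairs)
    show "T (a, b) $ i $ j = exp (z (a, b) $ Inl i + z (a, b) $ Inr j - l * M $ i $ j)" for i j
      by (simp add: T_def weight_def edge_inner)
    obtain \<alpha> where "\<And>p. 0 < \<alpha> p" "join_vec (a, b) = (\<Sum>p\<in>UNIV. \<alpha> p *\<^sub>R edge p)"
      using combination[OF w] by blast
    \<comment> \<open>The gauge correction vanishes here, so the marginals of
      \<open>T (a, b)\<close> are exactly \<open>a\<close> and \<open>b\<close>.\<close>
    then have "(\<Sum>p\<in>UNIV. weight (z (a, b)) p *\<^sub>R edge p) = join_vec (a, b)"
      using weights_dual[of \<alpha>] by (simp add: z_def)
    then show "T (a, b) \<in> transport_polytope a b"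
      by (simp add: sum_edge mem_transport_polytope T_def weight_def join_vec_def vec_eq_iff split_sum_all)
  qed
  have TA: "(\<lambda>w. T w $ i $ j) \<in> ?A" for i j
    unfolding T_def z_def by (auto intro: fun_algebra.gen basic_generators.weight)
  have zA: "(\<lambda>w. z w $ k) \<in> ?A" for k
    unfolding z_def by (auto intro: fun_algebra.gen basic_generators.coord)
  \<comment> \<open>On a Gibbs plan the logarithm is affine in the dual variables, which puts the
    entropy in the algebra.\<close>
  have "ln (T w $ i $ j) = z w $ Inl i + z w $ Inr j - l * M $ i $ j" for w i j
    by (simp add: T_def weight_def edge_inner)
  then have lnA: "(\<lambda>w. ln (T w $ i $ j)) \<in> ?A" for i j
    by (auto intro!: fun_algebra_diff fun_algebra.add fun_algebra.const zA)
  have frobA: "(\<lambda>w. frob_inner (T w) M) \<in> ?A"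
    unfolding frob_inner_sum by (intro fun_algebra_sum fun_algebra.mult TA fun_algebra.const)
  have "(\<lambda>w. \<Sum>i\<in>UNIV. \<Sum>j\<in>UNIV. T w $ i $ j * (ln (T w $ i $ j) - 1)) \<in> ?A"
    by (intro fun_algebra_sum fun_algebra.mult fun_algebra_diff TA lnA fun_algebra.const)
  then have "(\<lambda>w. frob_inner (T w) M
      + 1 / l * (\<Sum>i\<in>UNIV. \<Sum>j\<in>UNIV. T w $ i $ j * (ln (T w $ i $ j) - 1))) \<in> ?A"
    by (intro fun_algebra.add fun_algebra.mult fun_algebra.const frobA)
  then have regA: "(\<lambda>w. frob_inner (T w) M - 1 / l * entropy (T w)) \<in> ?A"
    by (simp add: entropy_def)
  note smooth = smooth_on_fun_algebra_generators[OF join combination]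
  have "smooth_on (\<lambda>(a, b). regularized_sinkhorn l M a b) S"
  proof (rule smooth_on_cong[OF smooth[OF _ regA]])
    fix w assume w: "w \<in> S"
    obtain a b where ab: "w = (a, b)"
      by (cases w)
    then have "a \<in> prob_simplex" "b \<in> prob_simplex"
      using w by (auto simp: S_def rel_interior_simplex_pairs)
    then show "(case w of (a, b) \<Rightarrow> regularized_sinkhorn l M a b)
        = frob_inner (T w) M - 1 / l * entropy (T w)"
      using w \<open>l > 0\<close> by (simp add: ab regularized_sinkhorn_eq plan)
  qed
  moreover have "smooth_on (\<lambda>(a, b). sharp_sinkhorn l M a b) S"
    by (rule smooth_on_cong[OF smooth[OF _ frobA]]) (auto simp: sharp_sinkhorn_def plan)
  ultimately show ?thesis
    by (simp add: M_def S_def)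
qed

end
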